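(* Let $(\mathcal{A},\mathcal{T})$ be an ALF instance with $\mathcal{A} = (\mathcal{C}, \mathcal{H}, (\mathcal{S},\sqsubseteq_\mathrm{s},\sqcup,\bot_\mathrm{s}), \gamma, \kappa)$ such that $\mathcal{T}$ is realizable, let $\preceq$ be a complexity ordering on $\mathcal{H}$, and let $\lambda$ be a $\preceq$-Occam learner. Then $\lambda$ converges, i.e., for every teacher $\tau$ for $(\mathcal{A},\mathcal{T})$ there is $n\in\mathbb{N}$ with $\gamma(\lambda(S_{\tau,\lambda}^n))\in\mathcal{T}$. Furthermore, the hypothesis $\lambda(S_{\tau,\lambda}^n)$ to which the learner converges is a $\preceq$-minimal target element, i.e., there is no $H'\in\mathcal{H}$ with $\gamma(H')\in\mathcal{T}$, $H'\preceq\lambda(S_{\tau,\lambda}^n)$ and $\lambda(S_{\tau,\lambda}^n)\not\preceq H'$.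
   Context: An abstract learning framework (ALF) is a tuple $\mathcal{A} = (\mathcal{C}, \mathcal{H}, (\mathcal{S},\sqsubseteq_\mathrm{s},\sqcup,\bot_\mathrm{s}), \gamma, \kappa)$ where $\mathcal{C}$ (concept space) and $\mathcal{H}$ (hypothesis space) are classes, $(\mathcal{S},\sqsubseteq_\mathrm{s},\sqcup,\bot_\mathrm{s})$ (sample space) is a join semi-lattice with least element $\bot_\mathrm{s}$, $\gamma:\mathcal{H}\to\mathcal{C}$, and $\kappa:\mathcal{S}\to 2^{\mathcal{C}}$ satisfies $\kappa(\bot_\mathrm{s})=\mathcal{C}$ and $\kappa(S_1\sqcup S_2)=\kappa(S_1)\cap\kappa(S_2)$. Let $\kappa_\mathcal{H}(S)=\{H\in\mathcal{H}\mid\gamma(H)\in\kappa(S)\}$; $S$ is realizable if $\kappa_\mathcal{H}(S)\neq\emptyset$. An ALF instance is $(\mathcal{A},\mathcal{T})$ with $\mathcal{T}\subseteq\mathcal{C}$; $\mathcal{T}$ is realizable if $\gamma(H)\in\mathcal{T}$ for some $H\in\mathcal{H}$. A learner is a map $\lambda:\mathcal{S}\to\mathcal{H}$, consistent if $\gamma(\lambda(S))\in\kappa(S)$ for all realizable $S$. A teacher is a map $\tau:\mathcal{H}\to\mathcal{S}$ with (progress) $\tau(H)=\bot_\mathrm{s}$ if $\gamma(H)\in\mathcal{T}$ and $\gamma(H)\notin\kappa(\tau(H))$ if $\gamma(H)\notin\mathcal{T}$, and (honesty) $\mathcal{T}\subseteq\kappa(\tau(H))$ for all $H$. The sample sequence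 is $S_{\tau,\lambda}^0=\bot_\mathrm{s}$ and $S_{\tau,\lambda}^{n+1}=S_{\tau,\lambda}^n\sqcup\tau(\lambda(S_{\tau,\lambda}^n))$ for $n\in\mathbb{N}$. A complexity ordering is a total quasi-order (reflexive, transitive, and any two elements comparable) $\preceq$ on $\mathcal{H}$ such that $\{y\in\mathcal{H}\mid y\preceq x\}$ is finite for every $x\in\mathcal{H}$. A $\preceq$-Occam learner is a consistent learner $\lambda$ that always constructs a smallest consistent hypothesis, i.e., for every realizable sample $S$, $\lambda(S)\preceq H$ for all $H\in\kappa_\mathcal{H}(S)$. *)

theory Defs
  imports "HOL-Algebra.Lattice"
begin

text \<open>
  The concept space, the hypothesis space and the sample space are carrier sets. In the
  sample space \<open>L\<close>, join and least element are the ones determined by the order,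
  written \<open>\<squnion>\<^bsub>L\<^esub>\<close> and \<open>\<bottom>\<^bsub>L\<^esub>\<close>.
\<close>

locale alf = L?: upper_semilattice L + L?: weak_partial_order_bottom L
  for C :: "'c set" and H :: "'h set" and L :: "'s gorder" (structure)
    and \<gamma> :: "'h \<Rightarrow> 'c" and \<kappa> :: "'s \<Rightarrow> 'c set" +
  assumes gamma_closed: "\<gamma> \<in> H \<rightarrow> C"
    and kappa_closed: "\<kappa> \<in> carrier L \<rightarrow> Pow C"
    and kappa_bottom: "\<kappa> \<bottom> = C"
    and kappa_join: "\<lbrakk>s \<in> carrier L; t \<in> carrier L\<rbrakk> \<Longrightarrow> \<kappa> (s \<squnion> t) = \<kappa> s \<inter> \<kappa> t"

locale alf_instance = alf C H L \<gamma> \<kappa>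
  for C :: "'c set" and H :: "'h set" and L :: "'s gorder" (structure)
    and \<gamma> :: "'h \<Rightarrow> 'c" and \<kappa> :: "'s \<Rightarrow> 'c set" and T :: "'c set" +
  assumes target_subset: "T \<subseteq> C"

definition consistent_hyps :: "'h set \<Rightarrow> ('h \<Rightarrow> 'c) \<Rightarrow> ('s \<Rightarrow> 'c set) \<Rightarrow> 's \<Rightarrow> 'h set" where
  "consistent_hyps H \<gamma> \<kappa> s = {h \<in> H. \<gamma> h \<in> \<kappa> s}"

definition realizable_sample :: "'h set \<Rightarrow> ('h \<Rightarrow> 'c) \<Rightarrow> ('s \<Rightarrow> 'c set) \<Rightarrow> 's \<Rightarrow> bool" where
  "realizable_sample H \<gamma> \<kappa> s \<longleftrightarrow> consistent_hyps H \<gamma> \<kappa> s \<noteq> {}"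

definition realizable_target :: "'h set \<Rightarrow> ('h \<Rightarrow> 'c) \<Rightarrow> 'c set \<Rightarrow> bool" where
  "realizable_target H \<gamma> T \<longleftrightarrow> (\<exists>h\<in>H. \<gamma> h \<in> T)"

definition learner :: "'h set \<Rightarrow> 's gorder \<Rightarrow> ('s \<Rightarrow> 'h) \<Rightarrow> bool" where
  "learner H L lam \<longleftrightarrow> lam \<in> carrier L \<rightarrow> H"

definition consistent_learner ::
  "'h set \<Rightarrow> 's gorder \<Rightarrow> ('h \<Rightarrow> 'c) \<Rightarrow> ('s \<Rightarrow> 'c set) \<Rightarrow> ('s \<Rightarrow> 'h) \<Rightarrow> bool" where
  "consistent_learner H L \<gamma> \<kappa> lam \<longleftrightarrow> learner H L lam \<and>
     (\<forall>s\<in>carrier L. realizable_sample H \<gamma> \<kappa> s \<longrightarrow> \<gamma> (lam s) \<in> \<kappa> s)"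

definition teacher ::
  "'h set \<Rightarrow> 's gorder \<Rightarrow> ('h \<Rightarrow> 'c) \<Rightarrow> ('s \<Rightarrow> 'c set) \<Rightarrow> 'c set \<Rightarrow> ('h \<Rightarrow> 's) \<Rightarrow> bool" where
  "teacher H L \<gamma> \<kappa> T \<tau> \<longleftrightarrow> \<tau> \<in> H \<rightarrow> carrier L \<and>
     (\<forall>h\<in>H. (\<gamma> h \<in> T \<longrightarrow> \<tau> h = \<bottom>\<^bsub>L\<^esub>) \<and> (\<gamma> h \<notin> T \<longrightarrow> \<gamma> h \<notin> \<kappa> (\<tau> h))) \<and>
     (\<forall>h\<in>H. T \<subseteq> \<kappa> (\<tau> h))"

primrec sample_seq :: "'s gorder \<Rightarrow> ('h \<Rightarrow> 's) \<Rightarrow> ('s \<Rightarrow> 'h) \<Rightarrow> nat \<Rightarrow> 's" where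
  "sample_seq L \<tau> lam 0 = \<bottom>\<^bsub>L\<^esub>"
| "sample_seq L \<tau> lam (Suc n) =
     sample_seq L \<tau> lam n \<squnion>\<^bsub>L\<^esub> \<tau> (lam (sample_seq L \<tau> lam n))"

definition converges ::
  "'h set \<Rightarrow> 's gorder \<Rightarrow> ('h \<Rightarrow> 'c) \<Rightarrow> ('s \<Rightarrow> 'c set) \<Rightarrow> 'c set \<Rightarrow> ('s \<Rightarrow> 'h) \<Rightarrow> bool" where
  "converges H L \<gamma> \<kappa> T lam \<longleftrightarrow>
     (\<forall>\<tau>. teacher H L \<gamma> \<kappa> T \<tau> \<longrightarrow> (\<exists>n. \<gamma> (lam (sample_seq L \<tau> lam n)) \<in> T))"

text \<open>
  \<^const>\<open>totalp_on\<close> only compares distinct elements; with reflexivity, any two elements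
  are comparable.
\<close>

definition complexity_ordering :: "'h set \<Rightarrow> ('h \<Rightarrow> 'h \<Rightarrow> bool) \<Rightarrow> bool" where
  "complexity_ordering H leq \<longleftrightarrow> reflp_on H leq \<and> transp_on H leq \<and> totalp_on H leq \<and>
     (\<forall>x\<in>H. finite {y \<in> H. leq y x})"

definition occam_learner ::
  "'h set \<Rightarrow> 's gorder \<Rightarrow> ('h \<Rightarrow> 'c) \<Rightarrow> ('s \<Rightarrow> 'c set) \<Rightarrow> ('h \<Rightarrow> 'h \<Rightarrow> bool) \<Rightarrow>
   ('s \<Rightarrow> 'h) \<Rightarrow> bool" where
  "occam_learner H L \<gamma> \<kappa> leq lam \<longleftrightarrow> consistent_learner H L \<gamma> \<kappa> lam \<and>
     (\<forall>s\<in>carrier L. realizable_sample H \<gamma> \<kappa> s \<longrightarrow>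
        (\<forall>h\<in>consistent_hyps H \<gamma> \<kappa> s. leq (lam s) h))"

definition minimal_target ::
  "'h set \<Rightarrow> ('h \<Rightarrow> 'c) \<Rightarrow> 'c set \<Rightarrow> ('h \<Rightarrow> 'h \<Rightarrow> bool) \<Rightarrow> 'h \<Rightarrow> bool" where
  "minimal_target H \<gamma> T leq h \<longleftrightarrow> h \<in> H \<and> \<gamma> h \<in> T \<and>
     \<not> (\<exists>h'\<in>H. \<gamma> h' \<in> T \<and> leq h' h \<and> \<not> leq h h')"

end

theory Submission
  imports Defs
begin

text \<open>
  By honesty every sample of the sequence is consistent with a fixed target hypothesis \<open>h\<close>, so
  the Occam learner always stays in the finite set of hypotheses below \<open>h\<close>. By progress a
  hypothesis outside the target is excluded by all later samples, so as long as the target is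
  missed no hypothesis is repeated; hence the target is reached. Minimality holds because each
  target hypothesis is a competitor that the learner's choice does not exceed.
\<close>

context alf_instance
begin

text \<open>Joins act on \<open>\<kappa>\<close> as intersections, and by honesty each intersected
  set contains \<open>T\<close>. Carrier membership is carried through the same induction because
  \<open>lam\<close> and \<open>kappa_join\<close> are controlled only on the carrier.\<close>

lemma sample_seq_closed_target:
  assumes "lam \<in> carrier L \<rightarrow> H" and "teacher H L \<gamma> \<kappa> T \<tau>"
  shows "sample_seq L \<tau> lam n \<in> carrier L \<and> T \<subseteq> \<kappa> (sample_seq L \<tau> lam n)"
proof (induction n)
  case 0
  show ?case
    using target_subset by (simp add: kappa_bottom)
next
  case (Suc n)
  moreover have "lam (sample_seq L \<tau> lam n) \<in> H"
    using Suc assms(1) by blast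
  moreover from this have "\<tau> (lam (sample_seq L \<tau> lam n)) \<in> carrier L"
    and "T \<subseteq> \<kappa> (\<tau> (lam (sample_seq L \<tau> lam n)))"
    using assms(2) by (auto simp: teacher_def)
  ultimately show ?case
    by (simp add: kappa_join)
qed

text \<open>The answer given in round \<open>m\<close> is joined in at index \<open>m + 1\<close>,
  and further joins can only shrink \<open>\<kappa>\<close>.\<close>

lemma kappa_sample_seq_later:
  assumes "lam \<in> carrier L \<rightarrow> H" and "teacher H L \<gamma> \<kappa> T \<tau>" and "m < n"
  shows "\<kappa> (sample_seq L \<tau> lam n) \<subseteq> \<kappa> (\<tau> (lam (sample_seq L \<tau> lam m)))"
  using assms(3)
proof (induction n)
  case 0
  then show ?case by simp
next
  case (Suc n)
  have closed: "sample_seq L \<tau> lam n \<in> carrier L"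
    using sample_seq_closed_target[OF assms(1,2)] by blast
  then have "\<tau> (lam (sample_seq L \<tau> lam n)) \<in> carrier L"
    using assms(1,2) by (auto simp: teacher_def Pi_iff)
  with closed have "\<kappa> (sample_seq L \<tau> lam (Suc n)) =
      \<kappa> (sample_seq L \<tau> lam n) \<inter> \<kappa> (\<tau> (lam (sample_seq L \<tau> lam n)))"
    by (simp add: kappa_join)
  \<comment> \<open>For \<open>m = n\<close> the inclusion comes from the second factor of the
    intersection, otherwise from the first by induction.\<close>
  with Suc show ?case
    by (cases "m = n") auto
qed

text \<open>The target hypothesis \<open>h\<close> is consistent with every sample of the sequence.
  It thus makes each sample realizable, which activates the guarantees of the learner, and is itself
  a competitor in the Occam condition.\<close>

lemma occam_learner_le_target:
  assumes occam: "occam_learner H L \<gamma> \<kappa> leq lam" and teacher: "teacher H L \<gamma> \<kappa> T \<tau>"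
    and "h \<in> H" and "\<gamma> h \<in> T"
  shows "lam (sample_seq L \<tau> lam n) \<in> H"
    and "\<gamma> (lam (sample_seq L \<tau> lam n)) \<in> \<kappa> (sample_seq L \<tau> lam n)"
    and "leq (lam (sample_seq L \<tau> lam n)) h"
proof -
  have lam: "lam \<in> carrier L \<rightarrow> H"
    using occam by (simp add: occam_learner_def consistent_learner_def learner_def)
  have closed: "sample_seq L \<tau> lam n \<in> carrier L"
    and target: "T \<subseteq> \<kappa> (sample_seq L \<tau> lam n)"
    using sample_seq_closed_target[OF lam teacher] by auto
  have consistent: "h \<in> consistent_hyps H \<gamma> \<kappa> (sample_seq L \<tau> lam n)"
    using assms(3,4) target by (auto simp: consistent_hyps_def)
  then have "realizable_sample H \<gamma> \<kappa> (sample_seq L \<tau> lam n)"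
    by (auto simp: realizable_sample_def)
  with lam closed consistent occam
  show "lam (sample_seq L \<tau> lam n) \<in> H"
    and "\<gamma> (lam (sample_seq L \<tau> lam n)) \<in> \<kappa> (sample_seq L \<tau> lam n)"
    and "leq (lam (sample_seq L \<tau> lam n)) h"
    by (auto simp: occam_learner_def consistent_learner_def)
qed

lemma occam_learner_converges:
  assumes "realizable_target H \<gamma> T" and "complexity_ordering H leq"
    and occam: "occam_learner H L \<gamma> \<kappa> leq lam"
  shows "converges H L \<gamma> \<kappa> T lam"
  unfolding converges_def
proof (intro allI impI, rule ccontr)
  fix \<tau>
  let ?S = "sample_seq L \<tau> lam"
  assume teacher: "teacher H L \<gamma> \<kappa> T \<tau>" and "\<nexists>n. \<gamma> (lam (?S n)) \<in> T"
  then have missed: "\<gamma> (lam (?S n)) \<notin> T" for n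
    by blast
  obtain h where h: "h \<in> H" "\<gamma> h \<in> T"
    using assms(1) by (auto simp: realizable_target_def)
  note bounds = occam_learner_le_target[OF occam teacher h]
  have lam: "lam \<in> carrier L \<rightarrow> H"
    using occam by (simp add: occam_learner_def consistent_learner_def learner_def)
  have "lam (?S m) \<noteq> lam (?S n)" if "m < n" for m n
  proof -
    have "\<gamma> (lam (?S m)) \<notin> \<kappa> (\<tau> (lam (?S m)))"
      using teacher bounds(1) missed by (auto simp: teacher_def)
    \<comment> \<open>The choice in round \<open>n\<close> is consistent with \<open>?S n\<close>,
      which already incorporates the answer of round \<open>m\<close>.\<close>
    moreover have "\<gamma> (lam (?S n)) \<in> \<kappa> (\<tau> (lam (?S m)))"
      using bounds(2) kappa_sample_seq_later[OF lam teacher that] by blast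
    ultimately show ?thesis by metis
  qed
  then have "inj (\<lambda>n. lam (?S n))"
    by (metis injI linorder_neqE_nat)
  moreover have "finite {y \<in> H. leq y h}"
    using assms(2) h(1) by (simp add: complexity_ordering_def)
  then have "finite (range (\<lambda>n. lam (?S n)))"
    by (rule rev_finite_subset) (use bounds in auto)
  \<comment> \<open>An injective sequence with finite range would make the set of all naturals
    finite.\<close>
  ultimately show False
    by (simp add: finite_image_iff)
qed

lemma occam_learner_minimal_target:
  assumes "occam_learner H L \<gamma> \<kappa> leq lam" and "teacher H L \<gamma> \<kappa> T \<tau>"
    and "\<gamma> (lam (sample_seq L \<tau> lam n)) \<in> T" and "realizable_target H \<gamma> T"
  shows "minimal_target H \<gamma> T leq (lam (sample_seq L \<tau> lam n))"
  \<comment> \<open>Realizability supplies an \<open>h\<close> for the first fact, which places the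
    choice in \<open>H\<close>; the third is applied to an arbitrary competitor
    \<open>h'\<close>.\<close>
  using assms occam_learner_le_target(1,3)[OF assms(1,2)]
  unfolding minimal_target_def realizable_target_def by blast

end

theorem theorem2:
  fixes C :: "'c set" and H :: "'h set" and L :: "'s gorder"
    and \<gamma> :: "'h \<Rightarrow> 'c" and \<kappa> :: "'s \<Rightarrow> 'c set" and T :: "'c set"
    and leq :: "'h \<Rightarrow> 'h \<Rightarrow> bool" and lam :: "'s \<Rightarrow> 'h"
  assumes "alf_instance C H L \<gamma> \<kappa> T"
    and "realizable_target H \<gamma> T"
    and "complexity_ordering H leq"
    and "occam_learner H L \<gamma> \<kappa> leq lam"
  shows "converges H L \<gamma> \<kappa> T lam \<and>
    (\<forall>\<tau> n. teacher H L \<gamma> \<kappa> T \<tau> \<longrightarrow> \<gamma> (lam (sample_seq L \<tau> lam n)) \<in> T \<longrightarrow>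
       minimal_target H \<gamma> T leq (lam (sample_seq L \<tau> lam n)))"
  using alf_instance.occam_learner_converges[OF assms]
    alf_instance.occam_learner_minimal_target[OF assms(1,4)] assms(2)
  by blast

end
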